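(* Let $N\ge2$, $0<\rho<\frac{\pi}{N+1}$, $\xi_i=\frac{i\pi}{N+1}$ and $s_i=[\cos(\xi_i+\rho),\cos(\xi_i-\rho)]$ for $i=1,\ldots,N$. Let $M_N\in\mathbb R^{N\times N}$ be defined by $$[M_N]_{i,k}=\int_{s_i}U_{k-1}(x)\,dx,\quad i,k=1,\ldots,N,$$ where $U_k$ is the Chebyshev polynomial of the second kind of degree $k$. Then $$[M_N]_{i,k}=\frac{2\sin(k\rho)}{k}\sin(k\xi_i),\quad i,k=1,\ldots,N.$$ Consequently, $$M_N^\top M_N=\operatorname{diag}\left(\frac{N+1}{2}\left[\frac{2\sin(k\rho)}{k}\right]^2\right)_{k=1}^N.$$ In particular, $M_N$ is nonsingular.
   Context: $U_k$ is characterized by $U_k(\cos\theta)\sin\theta=\sin((k+1)\theta)$, $0<\theta<\pi$. *)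

theory Defs
  imports
    "HOL-Analysis.Analysis"
    "HOL-Computational_Algebra.Polynomial"
    "Jordan_Normal_Form.Matrix"
begin

text \<open>
  The Chebyshev polynomials of the second kind are introduced by their trigonometric
  characterization. That it determines a unique polynomial, of degree \<open>k\<close>, is proved below.
\<close>

definition cheb_U :: "nat \<Rightarrow> real poly" where
  "cheb_U k = (THE p. \<forall>\<theta>. 0 < \<theta> \<and> \<theta> < pi \<longrightarrow>
     poly p (cos \<theta>) * sin \<theta> = sin (real (k + 1) * \<theta>))"

fun cheb_U_rec :: "nat \<Rightarrow> real poly" where
  "cheb_U_rec 0 = 1"
| "cheb_U_rec (Suc 0) = [:0, 2:]"
| "cheb_U_rec (Suc (Suc k)) = [:0, 2:] * cheb_U_rec (Suc k) - cheb_U_rec k"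

lemma poly_cheb_U_rec:
  "poly (cheb_U_rec k) (cos \<theta>) * sin \<theta> = sin (real (k + 1) * \<theta>)"
proof (induction k rule: cheb_U_rec.induct)
  case 1
  show ?case by simp
next
  case 2
  show ?case by (simp add: sin_double)
next
  case (3 k)
  have "poly (cheb_U_rec (Suc (Suc k))) (cos \<theta>) * sin \<theta>
      = 2 * cos \<theta> * (poly (cheb_U_rec (Suc k)) (cos \<theta>) * sin \<theta>)
        - poly (cheb_U_rec k) (cos \<theta>) * sin \<theta>"
    by (simp add: algebra_simps)
  also have "\<dots> = 2 * cos \<theta> * sin (real (k + 2) * \<theta>) - sin (real (k + 1) * \<theta>)"
    using 3 by simp
  also have "\<dots> = sin (real (k + 2) * \<theta> + \<theta>)"
  proof -
    have "real (k + 1) * \<theta> = real (k + 2) * \<theta> - \<theta>"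
      by (simp add: algebra_simps)
    then show ?thesis
      by (simp only: sin_add sin_diff) (simp add: algebra_simps)
  qed
  also have "real (k + 2) * \<theta> + \<theta> = real (Suc (Suc k) + 1) * \<theta>"
    by (simp add: algebra_simps)
  finally show ?case .
qed

lemma degree_cheb_U_rec: "degree (cheb_U_rec k) = k"
proof -
  have "degree (cheb_U_rec k) = k \<and> degree (cheb_U_rec (Suc k)) = Suc k"
  proof (induction k)
    case 0
    show ?case by simp
  next
    case (Suc k)
    then have nz: "cheb_U_rec (Suc k) \<noteq> 0"
      by auto
    have "degree ([:0, 2:] * cheb_U_rec (Suc k)) = Suc (Suc k)"
      using Suc nz by (subst degree_mult_eq) auto
    moreover have "degree (- cheb_U_rec k) < Suc (Suc k)"
      using Suc by simp
    ultimately have "degree ([:0, 2:] * cheb_U_rec (Suc k) + - cheb_U_rec k) = Suc (Suc k)"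
      by (subst degree_add_eq_left) simp_all
    then show ?case
      using Suc by simp
  qed
  then show ?thesis ..
qed

lemma cheb_U_unique:
  fixes p q :: "real poly"
  assumes p: "\<forall>\<theta>. 0 < \<theta> \<and> \<theta> < pi \<longrightarrow> poly p (cos \<theta>) * sin \<theta> = sin (real (k + 1) * \<theta>)"
    and q: "\<forall>\<theta>. 0 < \<theta> \<and> \<theta> < pi \<longrightarrow> poly q (cos \<theta>) * sin \<theta> = sin (real (k + 1) * \<theta>)"
  shows "p = q"
proof (rule ccontr)
  assume "p \<noteq> q"
  then have "finite {x. poly (p - q) x = 0}"
    by (intro poly_roots_finite) simp
  moreover have "{-1<..<1} \<subseteq> {x. poly (p - q) x = 0}"
  proof
    fix x :: real
    assume x: "x \<in> {-1<..<1}"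
    have \<theta>: "0 < arccos x" "arccos x < pi"
      using arccos_lt_bounded[of x] x by auto
    then have "sin (arccos x) \<noteq> 0"
      using sin_gt_zero[of "arccos x"] by simp
    moreover have "poly p (cos (arccos x)) * sin (arccos x)
        = poly q (cos (arccos x)) * sin (arccos x)"
      using p q \<theta> by simp
    moreover have "cos (arccos x) = x"
      using x by simp
    ultimately show "x \<in> {x. poly (p - q) x = 0}"
      by simp
  qed
  ultimately have "finite {-1<..<1::real}"
    by (rule rev_finite_subset)
  then show False
    using infinite_Ioo[of "-1::real" 1] by simp
qed

lemma cheb_U_eq_rec: "cheb_U k = cheb_U_rec k"
  unfolding cheb_U_def
proof (rule the_equality)
  show "\<forall>\<theta>. 0 < \<theta> \<and> \<theta> < pi \<longrightarrow>
      poly (cheb_U_rec k) (cos \<theta>) * sin \<theta> = sin (real (k + 1) * \<theta>)"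
    by (blast intro: poly_cheb_U_rec)
  then show "p = cheb_U_rec k"
    if "\<forall>\<theta>. 0 < \<theta> \<and> \<theta> < pi \<longrightarrow> poly p (cos \<theta>) * sin \<theta> = sin (real (k + 1) * \<theta>)" for p
    using cheb_U_unique[OF that] by blast
qed

lemma poly_cheb_U: "poly (cheb_U k) (cos \<theta>) * sin \<theta> = sin (real (k + 1) * \<theta>)"
  by (simp only: cheb_U_eq_rec poly_cheb_U_rec)

lemma degree_cheb_U: "degree (cheb_U k) = k"
  by (simp add: cheb_U_eq_rec degree_cheb_U_rec)

definition xi :: "nat \<Rightarrow> nat \<Rightarrow> real" where
  "xi N i = real i * pi / real (N + 1)"

definition seg :: "nat \<Rightarrow> real \<Rightarrow> nat \<Rightarrow> real set" where
  "seg N \<rho> i = {cos (xi N i + \<rho>)..cos (xi N i - \<rho>)}"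

text \<open>
  Matrix entries are indexed from 0, so the entry written \<open>[M]\<^sub>i\<^sub>,\<^sub>k\<close> with
  \<open>1 \<le> i, k \<le> N\<close> is found at position \<open>(i - 1, k - 1)\<close>.
\<close>

definition seg_mat :: "nat \<Rightarrow> real \<Rightarrow> real mat" where
  "seg_mat N \<rho> = Matrix.mat N N
     (\<lambda>(r, c). let i = r + 1; k = c + 1 in integral (seg N \<rho> i) (poly (cheb_U (k - 1))))"

end

theory Submission
  imports Defs "Jordan_Normal_Form.Determinant"
begin

text \<open>
  The substitution \<open>x = cos t\<close> turns \<open>U\<^bsub>k-1\<^esub>(x) dx\<close> into \<open>- sin (k t) dt\<close>, because
  \<open>U\<^bsub>k-1\<^esub>(cos t) sin t = sin (k t)\<close>. The arc \<open>[\<xi>\<^sub>i - \<rho>, \<xi>\<^sub>i + \<rho>]\<close> is mapped to the segment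
  \<open>s\<^sub>i\<close>, so the integral equals \<open>(cos (k (\<xi>\<^sub>i - \<rho>)) - cos (k (\<xi>\<^sub>i + \<rho>))) / k\<close>, and the
  difference of cosines splits as \<open>2 sin (k \<xi>\<^sub>i) sin (k \<rho>)\<close> (\<open>integral_cheb_U\<close>).

  Thus \<open>M\<^sub>N\<close> is the matrix \<open>(sin (k \<xi>\<^sub>i))\<^sub>i\<^sub>,\<^sub>k\<close> of the discrete sine transform with its columns
  scaled by \<open>2 sin (k \<rho>) / k\<close>. The columns of the sine transform are orthogonal with squared norm
  \<open>(N + 1) / 2\<close> (\<open>sum_sin_times_sin\<close>), which is the formula for the Gram matrix. The
  orthogonality reduces, by the product formula for sines, to sums of \<open>cos (i x)\<close> over
  \<open>i < N + 1\<close> with \<open>(N + 1) x = m \<pi>\<close>. Unless \<open>x\<close> is a multiple of \<open>2 \<pi>\<close>, such a sum depends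
  only on the parity of \<open>m\<close> (\<open>sum_cos_multiples\<close>). The two values \<open>m = j - k\<close> and \<open>m = j + k\<close>
  that occur have equal parity, so their sums cancel for \<open>j \<noteq> k\<close>.

  Since \<open>0 < k \<rho> < \<pi>\<close>, no scaling factor vanishes. A square matrix whose Gram matrix is diagonal
  with nonzero entries has a left inverse, hence is invertible.
\<close>

section \<open>Integrals of Chebyshev polynomials of the second kind\<close>

text \<open>
  Under \<open>x = cos t\<close> the integrand \<open>U\<^bsub>k-1\<^esub>(x) dx\<close> becomes \<open>- sin (k t) dt\<close>, which has the
  antiderivative \<open>cos (k t) / k\<close>.
\<close>

lemma integral_cheb_U_cos:
  assumes "a \<le> b" and "cos b \<le> cos a" and "k > 0"
  shows "integral {cos b..cos a} (poly (cheb_U (k - 1))) = (cos (real k * a) - cos (real k * b)) / real k"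
proof -
  let ?U = "poly (cheb_U (k - 1))"
  have U: "sin t * ?U (cos t) = sin (real k * t)" for t
    using poly_cheb_U[of "k - 1" t] \<open>k > 0\<close> by (simp add: mult.commute)
  \<comment> \<open>Reflecting the parameter makes \<open>cos\<close> traverse the segment from left to right.\<close>
  have "((\<lambda>t. (- sin t) *\<^sub>R ?U (cos t)) has_integral integral {cos (- b)..cos (- a)} ?U) {- b..- a}"
    by (rule has_integral_substitution[where c = "-1" and d = 1])
       (use assms in \<open>auto intro!: derivative_eq_intros continuous_intros\<close>)
  then have "((\<lambda>t. - sin (real k * t)) has_integral integral {cos b..cos a} ?U) {- b..- a}"
    by (simp add: U del: One_nat_def)
  moreover have "((\<lambda>t. - sin (real k * t)) has_integral
      cos (real k * - a) / real k - cos (real k * - b) / real k) {- b..- a}"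
    using assms
    by (intro fundamental_theorem_of_calculus)
       (auto intro!: derivative_eq_intros simp flip: has_real_derivative_iff_has_vector_derivative)
  ultimately have "integral {cos b..cos a} ?U
      = cos (real k * - a) / real k - cos (real k * - b) / real k"
    by (rule has_integral_unique)
  then show ?thesis
    by (simp add: diff_divide_distrib)
qed

lemma integral_cheb_U:
  assumes "0 \<le> \<rho>" "\<rho> \<le> pi" "0 \<le> x" "x \<le> pi" and "k > 0"
  shows "integral {cos (x + \<rho>)..cos (x - \<rho>)} (poly (cheb_U (k - 1)))
    = 2 * sin (real k * \<rho>) / real k * sin (real k * x)"
proof -
  have "cos (x - \<rho>) - cos (x + \<rho>) = 2 * sin x * sin \<rho>"
    by (simp add: cos_add cos_diff)
  moreover have "0 \<le> 2 * sin x * sin \<rho>"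
    using assms by (simp add: sin_ge_zero)
  ultimately have "cos (x + \<rho>) \<le> cos (x - \<rho>)"
    by linarith
  then show ?thesis
    using assms by (subst integral_cheb_U_cos) (simp_all add: algebra_simps cos_add cos_diff)
qed

section \<open>Orthogonality of the discrete sine transform\<close>

text \<open>
  Multiplying by \<open>2 sin (x / 2)\<close> makes the sum telescope to \<open>sin (n x - x / 2) + sin (x / 2)\<close>, and
  \<open>sin (n x) = 0\<close> leaves \<open>sin (x / 2)\<close> as a common factor. As \<open>n x\<close> is a multiple of \<open>\<pi>\<close>, the
  value is 0 or 1, according to the parity of that multiple.
\<close>

lemma sum_cos_multiples:
  fixes x :: real
  assumes "sin (x / 2) \<noteq> 0" and "sin (real n * x) = 0"
  shows "(\<Sum>i<n. cos (real i * x)) = (1 - cos (real n * x)) / 2"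
proof -
  have "2 * sin (x / 2) * (\<Sum>i<m. cos (real i * x)) = sin (real m * x - x / 2) + sin (x / 2)" for m
  proof (induction m)
    case 0
    show ?case by simp
  next
    case (Suc m)
    have "real (Suc m) * x - x / 2 = real m * x + x / 2"
      by (simp add: algebra_simps)
    then have "sin (real (Suc m) * x - x / 2)
        = sin (real m * x - x / 2) + 2 * sin (x / 2) * cos (real m * x)"
      by (simp only: sin_add sin_diff) simp
    with Suc show ?case
      by (simp add: algebra_simps)
  qed
  from this[of n] have "2 * sin (x / 2) * (\<Sum>i<n. cos (real i * x))
      = sin (x / 2) * (1 - cos (real n * x))"
    using assms(2) by (simp add: sin_diff algebra_simps)
  then have "2 * (\<Sum>i<n. cos (real i * x)) = 1 - cos (real n * x)"
    using assms(1) by (simp add: mult.assoc mult.left_commute)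
  then show ?thesis
    by simp
qed

text \<open>
  For \<open>j \<noteq> k\<close> both cosine sums in the product formula take the same value and cancel. For
  \<open>j = k\<close> the difference frequency is 0 and its sum is \<open>n\<close>, while the other sum vanishes.
\<close>

lemma sum_sin_times_sin:
  assumes j: "0 < j" "j < n" and k: "0 < k" "k < n"
  shows "(\<Sum>i<n. sin (real j * (real i * pi / real n)) * sin (real k * (real i * pi / real n)))
    = (if j = k then real n / 2 else 0)"
proof -
  define x where "x = (real j - real k) * pi / real n"
  define y where "y = (real j + real k) * pi / real n"
  have n: "real n > 0"
    using j by simp
  have nx: "real n * x = real j * pi - real k * pi" and ny: "real n * y = real j * pi + real k * pi"
    using n by (simp_all add: x_def y_def field_simps)
  have zero: "sin (real n * x) = 0" "sin (real n * y) = 0"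
    by (simp_all add: nx ny sin_add sin_diff)
  have same: "cos (real n * x) = cos (real n * y)"
    by (simp add: nx ny cos_add cos_diff)
  have less_pi: "m * pi / real n / 2 < pi" if "m < 2 * real n" for m
    using mult_strict_right_mono[OF that pi_gt_zero] n by (simp add: field_simps)
  have "0 < y / 2" "y / 2 < pi"
    using assms less_pi[of "real j + real k"] by (simp_all add: y_def)
  then have sum_y: "(\<Sum>i<n. cos (real i * y)) = (1 - cos (real n * y)) / 2"
    using sin_gt_zero[of "y / 2"] zero by (intro sum_cos_multiples) auto
  have "(\<Sum>i<n. sin (real j * (real i * pi / real n)) * sin (real k * (real i * pi / real n)))
      = (\<Sum>i<n. (cos (real i * x) - cos (real i * y)) / 2)"
    by (intro sum.cong refl)
      (simp add: sin_times_sin x_def y_def algebra_simps diff_divide_distrib add_divide_distrib)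
  also have "\<dots> = ((\<Sum>i<n. cos (real i * x)) - (\<Sum>i<n. cos (real i * y))) / 2"
    by (simp add: sum_subtractf flip: sum_divide_distrib)
  also have "\<dots> = (if j = k then real n / 2 else 0)"
  proof (cases "j = k")
    case True
    then have "x = 0"
      by (simp add: x_def)
    then show ?thesis
      using True same by (simp add: sum_y)
  next
    case False
    have "x / 2 \<noteq> 0"
      using False n by (simp add: x_def)
    moreover have "- pi < x / 2" "x / 2 < pi"
      using less_pi[of "real j - real k"] less_pi[of "real k - real j"] assms
      by (simp_all add: x_def left_diff_distrib diff_divide_distrib)
    ultimately have "sin (x / 2) \<noteq> 0"
      using sin_eq_0_pi by blast
    then show ?thesis
      using False zero same by (simp add: sum_y sum_cos_multiples)
  qed
  finally show ?thesis .
qed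

section \<open>Invertibility from a diagonal Gram matrix\<close>

lemma invertible_mat_if_diagonal_gram:
  fixes A :: "'a :: field mat"
  assumes A: "A \<in> carrier_mat n n"
    and gram: "transpose_mat A * A = mat_diag n d"
    and nz: "\<And>i. i < n \<Longrightarrow> d i \<noteq> 0"
  shows "invertible_mat A"
proof -
  define B where "B = mat_diag n (\<lambda>i. 1 / d i) * transpose_mat A"
  have B: "B \<in> carrier_mat n n"
    using A mult_carrier_mat[OF mat_diag_dim, of "transpose_mat A" n] by (simp add: B_def)
  have "B * A = mat_diag n (\<lambda>i. 1 / d i) * (transpose_mat A * A)"
    unfolding B_def using A by (intro assoc_mult_mat[OF mat_diag_dim]) auto
  also have "\<dots> = 1\<^sub>m n"
    unfolding gram mat_diag_diag using nz by (auto simp: mat_diag_def intro!: eq_matI)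
  finally have BA: "B * A = 1\<^sub>m n" .
  then have "A * B = 1\<^sub>m n"
    using mat_mult_left_right_inverse A B by blast
  with BA A B show ?thesis
    by (auto simp: invertible_mat_def inverts_mat_def)
qed

section \<open>The segment matrix\<close>

theorem proposition4:
  fixes N :: nat and \<rho> :: real
  assumes "N \<ge> 2" and "0 < \<rho>" and "\<rho> < pi / real (N + 1)"
  shows "(\<forall>i\<in>{1..N}. \<forall>k\<in>{1..N}.
            seg_mat N \<rho> $$ (i - 1, k - 1)
              = 2 * sin (real k * \<rho>) / real k * sin (real k * xi N i))
       \<and> transpose_mat (seg_mat N \<rho>) * seg_mat N \<rho>
           = mat_diag N (\<lambda>c. let k = c + 1 in
               real (N + 1) / 2 * (2 * sin (real k * \<rho>) / real k)\<^sup>2)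
       \<and> invertible_mat (seg_mat N \<rho>)"
proof -
  let ?M = "seg_mat N \<rho>"
  define c where "c k = 2 * sin (real k * \<rho>) / real k" for k
  define d where "d l = (let k = l + 1 in real (N + 1) / 2 * (2 * sin (real k * \<rho>) / real k)\<^sup>2)" for l
  have d: "d l = real (N + 1) / 2 * (c (Suc l))\<^sup>2" for l
    by (simp add: d_def c_def)
  have M: "?M \<in> carrier_mat N N"
    by (simp add: seg_mat_def)
  have k\<rho>: "0 < real k * \<rho>" "real k * \<rho> < pi" if "0 < k" "k \<le> N" for k
  proof -
    show "0 < real k * \<rho>"
      using that assms by simp
    have "real k * \<rho> < real (N + 1) * \<rho>"
      using that assms by (intro mult_strict_right_mono) simp_all
    also have "\<dots> < pi"
      using assms by (simp add: field_simps)
    finally show "real k * \<rho> < pi" .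
  qed
  have xi: "0 \<le> xi N i" "xi N i \<le> pi" if "i \<le> N" for i
    using that mult_right_mono[of "real i" "real (N + 1)" pi]
    by (simp_all add: xi_def pos_divide_le_eq mult.commute)
  have entry: "?M $$ (r, l) = c (Suc l) * sin (real (Suc l) * xi N (Suc r))"
    if "r < N" "l < N" for r l
    using integral_cheb_U[of \<rho> "xi N (Suc r)" "Suc l"] k\<rho>[of 1] xi[of "Suc r"] that assms(1)
    by (simp add: seg_mat_def seg_def c_def)
  have gram: "transpose_mat ?M * ?M = mat_diag N d"
  proof (rule eq_matI)
    fix j k assume "j < dim_row (mat_diag N d)" "k < dim_col (mat_diag N d)"
    then have jk: "j < N" "k < N"
      by (simp_all add: mat_diag_def)
    let ?s = "\<lambda>k i. sin (real (Suc k) * xi N i)"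
    have "(transpose_mat ?M * ?M) $$ (j, k) = (\<Sum>r<N. ?M $$ (r, j) * ?M $$ (r, k))"
      using jk M by (simp add: scalar_prod_def lessThan_atLeast0)
    also have "\<dots> = (\<Sum>r<N. c (Suc j) * c (Suc k) * (?s j (Suc r) * ?s k (Suc r)))"
      using jk by (intro sum.cong) (simp_all add: entry)
    also have "\<dots> = c (Suc j) * c (Suc k) * (\<Sum>r<N. ?s j (Suc r) * ?s k (Suc r))"
      by (simp add: sum_distrib_left)
    \<comment> \<open>The node \<open>\<xi>\<^sub>0 = 0\<close>, where all sines vanish, completes the sum to \<open>N + 1\<close> equispaced nodes.\<close>
    also have "(\<Sum>r<N. ?s j (Suc r) * ?s k (Suc r)) = (\<Sum>i<Suc N. ?s j i * ?s k i)"
      by (subst sum.lessThan_Suc_shift) (simp add: xi_def)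
    also have "\<dots> = (if j = k then real (N + 1) / 2 else 0)"
      using sum_sin_times_sin[of "Suc j" "Suc N" "Suc k"] jk
      by (simp add: xi_def)
    finally show "(transpose_mat ?M * ?M) $$ (j, k) = mat_diag N d $$ (j, k)"
      using jk by (simp add: mat_diag_def d power2_eq_square)
  qed (use M in \<open>simp_all add: mat_diag_def\<close>)
  have "d l \<noteq> 0" if "l < N" for l
    using sin_gt_zero[OF k\<rho>[of "Suc l"]] that by (simp add: d c_def)
  then have inv: "invertible_mat ?M"
    using invertible_mat_if_diagonal_gram[OF M gram] by blast
  have "?M $$ (i - 1, k - 1) = c k * sin (real k * xi N i)" if "i \<in> {1..N}" "k \<in> {1..N}" for i k
    using entry[of "i - 1" "k - 1"] that by force
  then show ?thesis
    using gram inv unfolding c_def d_def by blast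
qed

end
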